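(* For integers $m,n\geq 2$, let $G(m,n)$ be the grid graph, i.e. the Cartesian product $P_m \,\square\, P_n$ of paths on $m$ and $n$ vertices. Then $\check s(G(m,n))=1$ if $m=n=2$; $\check s(G(m,n))=2$ if $\min\{m,n\}=2$ and $\max\{m,n\}\geq 3$; $\check s(G(m,n))=3$ if $m,n\geq 3$ and $mn$ is even; and $\check s(G(m,n))=5$ if $m,n\geq 3$ and $mn$ is odd.
   Context: For a proper edge coloring $\varphi$ of a graph $G$, the palette of a vertex $v$ is the set of colors on edges incident with $v$. The palette index $\check s(G)$ is the minimum number of distinct palettes over all proper edge colorings of $G$. Concretely, $G(m,n)$ has vertex set $\{v^{(i)}_j : 1\le i\le m, 1\le j\le n\}$ and edges $v^{(i)}_jv^{(i)}_{j+1}$ and $v^{(i)}_jv^{(i+1)}_j$. *)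

theory Defs
  imports Main
begin

record 'a ugraph =
  verts :: "'a set"
  edges :: "'a set set"

definition simple_graph :: "'a ugraph \<Rightarrow> bool" where
  "simple_graph G \<longleftrightarrow> (\<forall>e\<in>edges G. e \<subseteq> verts G \<and> card e = 2)"

text \<open>Colourings are total functions on vertex sets; only their values on edges matter.
  Natural numbers supply enough colours for every finite graph.\<close>

definition proper_edge_coloring :: "'a ugraph \<Rightarrow> ('a set \<Rightarrow> nat) \<Rightarrow> bool" where
  "proper_edge_coloring G \<phi> \<longleftrightarrow>
     (\<forall>e\<in>edges G. \<forall>f\<in>edges G. e \<noteq> f \<and> e \<inter> f \<noteq> {} \<longrightarrow> \<phi> e \<noteq> \<phi> f)"

definition palette :: "'a ugraph \<Rightarrow> ('a set \<Rightarrow> nat) \<Rightarrow> 'a \<Rightarrow> nat set" where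
  "palette G \<phi> v = \<phi> ` {e \<in> edges G. v \<in> e}"

definition palette_index :: "'a ugraph \<Rightarrow> nat" where
  "palette_index G =
     (LEAST k. \<exists>\<phi>. proper_edge_coloring G \<phi> \<and> card (palette G \<phi> ` verts G) = k)"

definition path_graph :: "nat \<Rightarrow> nat ugraph" where
  "path_graph n = \<lparr>verts = {1..n}, edges = {{i, i + 1} | i. 1 \<le> i \<and> i + 1 \<le> n}\<rparr>"

definition cartesian_product :: "'a ugraph \<Rightarrow> 'b ugraph \<Rightarrow> ('a \<times> 'b) ugraph" where
  "cartesian_product G H =
     \<lparr>verts = verts G \<times> verts H,
      edges = {{(a, b), (a, b')} | a b b'. a \<in> verts G \<and> {b, b'} \<in> edges H}
            \<union> {{(a, b), (a', b)} | a a' b. {a, a'} \<in> edges G \<and> b \<in> verts H}\<rparr>"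

definition grid_graph :: "nat \<Rightarrow> nat \<Rightarrow> (nat \<times> nat) ugraph" where
  "grid_graph m n = cartesian_product (path_graph m) (path_graph n)"

lemma verts_grid_graph: "verts (grid_graph m n) = {1..m} \<times> {1..n}"
  by (simp add: grid_graph_def cartesian_product_def path_graph_def)

lemma edges_grid_graph:
  "edges (grid_graph m n) =
     {{(i, j), (i, j + 1)} | i j. 1 \<le> i \<and> i \<le> m \<and> 1 \<le> j \<and> j + 1 \<le> n}
   \<union> {{(i, j), (i + 1, j)} | i j. 1 \<le> i \<and> i + 1 \<le> m \<and> 1 \<le> j \<and> j \<le> n}"
proof -
  have e: "{b, b'} \<in> edges (path_graph k) \<longleftrightarrow>
      (1 \<le> b \<and> b' = b + 1 \<and> b' \<le> k) \<or> (1 \<le> b' \<and> b = b' + 1 \<and> b \<le> k)" for b b' k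
    by (auto simp: path_graph_def doubleton_eq_iff)
  have v: "verts (path_graph k) = {1..k}" for k
    by (simp add: path_graph_def)
  have 1: "{{(a, b), (a, b')} | a b b'. a \<in> {1..m} \<and>
        ((1 \<le> b \<and> b' = b + 1 \<and> b' \<le> n) \<or> (1 \<le> b' \<and> b = b' + 1 \<and> b \<le> n))}
      = {{(i, j), (i, j + 1)} | i j. 1 \<le> i \<and> i \<le> m \<and> 1 \<le> j \<and> j + 1 \<le> n}"
    (is "?L = ?R")
  proof
    show "?L \<subseteq> ?R" by (clarsimp, elim disjE) (force simp: insert_commute)+
    show "?R \<subseteq> ?L" by (clarsimp, force)
  qed
  have 2: "{{(a, b), (a', b)} | a a' b.
        ((1 \<le> a \<and> a' = a + 1 \<and> a' \<le> m) \<or> (1 \<le> a' \<and> a = a' + 1 \<and> a \<le> m)) \<and> b \<in> {1..n}}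
      = {{(i, j), (i + 1, j)} | i j. 1 \<le> i \<and> i + 1 \<le> m \<and> 1 \<le> j \<and> j \<le> n}"
    (is "?L = ?R")
  proof
    show "?L \<subseteq> ?R" by (clarsimp, elim disjE) (force simp: insert_commute)+
    show "?R \<subseteq> ?L" by (clarsimp, force)
  qed
  show ?thesis
    unfolding grid_graph_def cartesian_product_def ugraph.simps e v 1 2 ..
qed

lemma simple_graph_grid_graph: "simple_graph (grid_graph m n)"
  unfolding simple_graph_def edges_grid_graph verts_grid_graph by auto

lemma palette_index_attained:
  assumes "finite (edges G)"
  shows "\<exists>\<phi>. proper_edge_coloring G \<phi> \<and> card (palette G \<phi> ` verts G) = palette_index G"
proof -
  obtain \<phi> :: "'a set \<Rightarrow> nat" where "inj_on \<phi> (edges G)"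
    using finite_imp_inj_to_nat_seg[OF assms] by blast
  then have "proper_edge_coloring G \<phi>"
    by (auto simp: proper_edge_coloring_def inj_on_def)
  then have "\<exists>k \<phi>. proper_edge_coloring G \<phi> \<and> card (palette G \<phi> ` verts G) = k"
    by blast
  then show ?thesis
    unfolding palette_index_def by (rule LeastI_ex)
qed

end

theory Submission
  imports Defs
begin

text \<open>
  In a proper colouring the palette of a vertex has as many elements as its degree, so the number of
  distinct degrees is a lower bound. If one side length is even, there is a colouring in which every
  vertex \<open>x\<close> has palette \<open>{1..degree x}\<close>, so the bound is attained.

  If both side lengths are odd, there are four corners, an even number of side vertices and an odd
  number of interior vertices, while every colour is seen by an even number of vertices. With at most
  four palettes, parity and the fact that corners have only side vertices as neighbours exclude
  all cases except that of a single corner palette \<open>C\<close>, a single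
  interior palette \<open>D\<close> and two side palettes \<open>P\<close>, \<open>Q\<close>, each occurring an odd number of times.
  Then \<open>D\<close> is the symmetric difference of \<open>P\<close> and \<open>Q\<close>, and \<open>P \<inter> Q = {x}\<close> with \<open>x \<notin> D\<close>, so every
  side vertex has its \<open>x\<close>-edge on the boundary cycle. As the sides have odd length, \<open>x \<in> C\<close>; the other
  element of \<open>C\<close> misses one of \<open>P\<close>, \<open>Q\<close>, say \<open>Q\<close>. The boundary edges with colours in \<open>Q - {x}\<close> then
  match the vertices with palette \<open>Q\<close> in pairs, a contradiction.
\<close>

section \<open>Palettes and degrees\<close>

definition incident_edges :: "'a ugraph \<Rightarrow> 'a \<Rightarrow> 'a set set" where
  "incident_edges G v = {e \<in> edges G. v \<in> e}"

definition degree :: "'a ugraph \<Rightarrow> 'a \<Rightarrow> nat" where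
  "degree G v = card (incident_edges G v)"

lemma palette_eq_image: "palette G \<phi> v = \<phi> ` incident_edges G v"
  by (simp add: palette_def incident_edges_def)

lemma proper_edge_coloringD:
  assumes "proper_edge_coloring G \<phi>" "e \<in> edges G" "f \<in> edges G" "v \<in> e" "v \<in> f" "\<phi> e = \<phi> f"
  shows "e = f"
  using assms unfolding proper_edge_coloring_def by blast

lemma card_palette_eq_degree:
  assumes "proper_edge_coloring G \<phi>"
  shows "card (palette G \<phi> v) = degree G v"
  unfolding palette_eq_image degree_def
  by (intro card_image inj_onI, rule proper_edge_coloringD[OF assms])
    (auto simp: incident_edges_def)

text \<open>Edges that meet share a vertex. There the palette is the image of the incident edges
  under \<open>\<phi>\<close>, and equal cardinality forces \<open>\<phi>\<close> to be injective on
  them. Explicit colourings can thus be verified through their palettes alone.\<close>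

lemma proper_edge_coloringI:
  assumes "simple_graph G" "finite (edges G)"
    and "\<And>v. v \<in> verts G \<Longrightarrow> card (palette G \<phi> v) = degree G v"
  shows "proper_edge_coloring G \<phi>"
  unfolding proper_edge_coloring_def
proof (intro ballI impI)
  fix e f assume ef: "e \<in> edges G" "f \<in> edges G" "e \<noteq> f \<and> e \<inter> f \<noteq> {}"
  then obtain v where v: "v \<in> e" "v \<in> f" by blast
  then have "v \<in> verts G" using assms(1) ef(1) by (auto simp: simple_graph_def)
  then have "inj_on \<phi> (incident_edges G v)"
    using assms(2,3) unfolding palette_eq_image degree_def
    by (intro eq_card_imp_inj_on) (auto simp: incident_edges_def)
  then show "\<phi> e \<noteq> \<phi> f"
    using ef v by (auto simp: incident_edges_def inj_on_def)
qed

lemma palette_index_le: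
  assumes "proper_edge_coloring G \<phi>" "palette G \<phi> ` verts G \<subseteq> S" "finite S"
  shows "palette_index G \<le> card S"
proof -
  have "palette_index G \<le> card (palette G \<phi> ` verts G)"
    unfolding palette_index_def by (rule Least_le) (use assms(1) in blast)
  also have "\<dots> \<le> card S" using assms by (simp add: card_mono)
  finally show ?thesis .
qed

text \<open>The cardinality of a palette is the degree, so \<open>card\<close> maps the palettes of
  an optimal colouring onto the degrees.\<close>

lemma card_degrees_le_palette_index:
  assumes "finite (edges G)" "finite (verts G)"
  shows "card (degree G ` verts G) \<le> palette_index G"
proof -
  obtain \<phi> where \<phi>: "proper_edge_coloring G \<phi>" "card (palette G \<phi> ` verts G) = palette_index G"
    using palette_index_attained[OF assms(1)] by blast
  have "degree G ` verts G = card ` palette G \<phi> ` verts G"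
    unfolding image_image using card_palette_eq_degree[OF \<phi>(1)] by simp
  then show ?thesis
    using card_image_le[of "palette G \<phi> ` verts G" card] assms(2) \<phi>(2) by simp
qed

section \<open>Colour classes as matchings\<close>

lemma card_Union_disjoint_pairs:
  assumes "finite M" "\<And>e. e \<in> M \<Longrightarrow> card e = 2"
    and "\<And>e f v. e \<in> M \<Longrightarrow> f \<in> M \<Longrightarrow> v \<in> e \<Longrightarrow> v \<in> f \<Longrightarrow> e = f"
  shows "card (\<Union>M) = 2 * card M"
proof -
  have "card (\<Union>M) = sum card M"
  proof (rule card_Union_disjoint)
    show "pairwise disjnt M"
      using assms(3) by (force simp: pairwise_def disjnt_iff)
    show "finite e" if "e \<in> M" for e
      using assms(2)[OF that] by (simp add: card_ge_0_finite)
  qed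
  also have "\<dots> = 2 * card M" using assms(2) by simp
  finally show ?thesis .
qed

text \<open>The edges of colour \<open>c\<close> form a matching, and the vertices it covers are
  exactly those that see \<open>c\<close>.\<close>

lemma even_card_vertices_with_color:
  assumes "simple_graph G" "finite (edges G)" "proper_edge_coloring G \<phi>"
  shows "even (card {v \<in> verts G. c \<in> palette G \<phi> v})"
proof -
  let ?M = "{e \<in> edges G. \<phi> e = c}"
  have "{v \<in> verts G. c \<in> palette G \<phi> v} = \<Union>?M"
    using assms(1) by (auto simp: palette_def simple_graph_def)
  moreover have "card (\<Union>?M) = 2 * card ?M"
  proof (rule card_Union_disjoint_pairs)
    show "e = f" if "e \<in> ?M" "f \<in> ?M" "v \<in> e" "v \<in> f" for e f v
      using that proper_edge_coloringD[OF assms(3)] by simp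
  qed (use assms in \<open>auto simp: simple_graph_def\<close>)
  ultimately show ?thesis by simp
qed

text \<open>An optimal colouring of \<open>G\<close> is carried to \<open>H\<close> by taking
  preimages of edges; injectivity of \<open>f\<close> makes \<open>f -\<close> undo the image. This
  serves to exchange the two coordinates of a grid.\<close>

lemma palette_index_image_le:
  assumes "inj f" "verts H = f ` verts G" "edges H = image f ` edges G" "finite (edges G)" "finite (verts G)"
  shows "palette_index H \<le> palette_index G"
proof -
  obtain \<phi> where \<phi>: "proper_edge_coloring G \<phi>" "card (palette G \<phi> ` verts G) = palette_index G"
    using palette_index_attained[OF assms(4)] by blast
  define \<psi> where "\<psi> e = \<phi> (f -` e)" for e
  have \<psi>: "\<psi> (f ` e) = \<phi> e" for e
    by (simp add: \<psi>_def inj_vimage_image_eq[OF assms(1)])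
  have "proper_edge_coloring H \<psi>"
    using \<phi>(1) unfolding proper_edge_coloring_def assms(3)
    by (auto simp: \<psi> simp flip: image_Int[OF assms(1)])
  moreover have "palette H \<psi> (f v) = palette G \<phi> v" for v
  proof -
    have "{e \<in> edges H. f v \<in> e} = image f ` {e \<in> edges G. v \<in> e}"
    proof (intro equalityI subsetI)
      fix e assume "e \<in> {e \<in> edges H. f v \<in> e}"
      then obtain d where "e = f ` d" "d \<in> edges G" "f v \<in> f ` d" by (auto simp: assms(3))
      then show "e \<in> image f ` {e \<in> edges G. v \<in> e}"
        using inj_image_mem_iff[OF assms(1)] by blast
    qed (auto simp: assms(3))
    then show ?thesis by (simp add: palette_def image_image \<psi>)
  qed
  then have "palette H \<psi> ` verts H = palette G \<phi> ` verts G"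
    by (simp add: assms(2) image_image)
  ultimately show ?thesis
    using palette_index_le[of H \<psi> "palette G \<phi> ` verts G"] \<phi>(2) assms(5) by simp
qed

section \<open>Grid graphs\<close>

lemma finite_verts_grid: "finite (verts (grid_graph m n))"
  by (simp add: verts_grid_graph)

lemma finite_edges_grid: "finite (edges (grid_graph m n))"
proof (rule finite_subset)
  show "edges (grid_graph m n) \<subseteq> Pow (verts (grid_graph m n))"
    using simple_graph_grid_graph[of m n] by (auto simp: simple_graph_def)
qed (simp add: finite_verts_grid)

lemma hedge_in_edges:
  "{(i, j), (i, Suc j)} \<in> edges (grid_graph m n) \<longleftrightarrow> 1 \<le> i \<and> i \<le> m \<and> 1 \<le> j \<and> j < n"
  by (fastforce simp: edges_grid_graph doubleton_eq_iff)

lemma vedge_in_edges: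
  "{(i, j), (Suc i, j)} \<in> edges (grid_graph m n) \<longleftrightarrow> 1 \<le> i \<and> i < m \<and> 1 \<le> j \<and> j \<le> n"
  by (fastforce simp: edges_grid_graph doubleton_eq_iff)

lemma palette_index_grid_commute_le:
  "palette_index (grid_graph n m) \<le> palette_index (grid_graph m n)"
proof (rule palette_index_image_le[where f = prod.swap])
  show "verts (grid_graph n m) = prod.swap ` verts (grid_graph m n)"
    by (force simp: verts_grid_graph)
  show "edges (grid_graph n m) = image prod.swap ` edges (grid_graph m n)"
  proof -
    have sub: "prod.swap ` e \<in> edges (grid_graph l k)" if "e \<in> edges (grid_graph k l)" for e k l
      using that by (subst (asm) edges_grid_graph) (auto simp: hedge_in_edges vedge_in_edges)
    have "e \<in> image prod.swap ` edges (grid_graph m n)" if "e \<in> edges (grid_graph n m)" for e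
      using sub[OF that] by (intro image_eqI[where x = "prod.swap ` e"]) (auto simp: image_image)
    then show ?thesis using sub by (intro equalityI image_subsetI subsetI)
  qed
qed (simp_all add: finite_edges_grid finite_verts_grid)

lemma palette_index_grid_commute:
  "palette_index (grid_graph m n) = palette_index (grid_graph n m)"
  by (intro antisym palette_index_grid_commute_le)

section \<open>Incident edges and degrees in coordinates\<close>

abbreviation hedge :: "nat \<Rightarrow> nat \<Rightarrow> (nat \<times> nat) set" where
  "hedge i j \<equiv> {(i, j), (i, j + 1)}"

abbreviation vedge :: "nat \<Rightarrow> nat \<Rightarrow> (nat \<times> nat) set" where
  "vedge i j \<equiv> {(i, j), (i + 1, j)}"

lemma incident_edges_grid:
  assumes "(i, j) \<in> verts (grid_graph m n)"
  shows "incident_edges (grid_graph m n) (i, j) =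
    (if 1 < j then {hedge i (j - 1)} else {}) \<union> (if j < n then {hedge i j} else {}) \<union>
    (if 1 < i then {vedge (i - 1) j} else {}) \<union> (if i < m then {vedge i j} else {})"
    (is "_ = ?R")
proof
  show "incident_edges (grid_graph m n) (i, j) \<subseteq> ?R"
  proof
    fix e assume "e \<in> incident_edges (grid_graph m n) (i, j)"
    then consider (h) a b where "e = hedge a b" "0 < b" "b < n" "i = a" "j = b \<or> j = Suc b"
      | (v) a b where "e = vedge a b" "0 < a" "a < m" "j = b" "i = a \<or> i = Suc a"
      unfolding incident_edges_def edges_grid_graph by fastforce
    then show "e \<in> ?R"
    proof cases
      case h
      from h(5) show ?thesis by (elim disjE) (simp_all add: h(1-4))
    next
      case v
      from v(5) show ?thesis by (elim disjE) (simp_all add: v(1-4))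
    qed
  qed
  \<comment> \<open>With both coordinates written as successors, the truncated differences
    \<open>i - 1\<close> and \<open>j - 1\<close> simplify away.\<close>
  obtain i' j' where "i = Suc i'" "j = Suc j'"
    using assms by (cases i; cases j) (auto simp: verts_grid_graph)
  then show "?R \<subseteq> incident_edges (grid_graph m n) (i, j)"
    using assms by (simp add: incident_edges_def hedge_in_edges vedge_in_edges verts_grid_graph)
qed

lemma palette_grid:
  assumes "(i, j) \<in> verts (grid_graph m n)"
  shows "palette (grid_graph m n) \<phi> (i, j) =
    (if 1 < j then {\<phi> (hedge i (j - 1))} else {}) \<union> (if j < n then {\<phi> (hedge i j)} else {}) \<union>
    (if 1 < i then {\<phi> (vedge (i - 1) j)} else {}) \<union> (if i < m then {\<phi> (vedge i j)} else {})"
  unfolding palette_eq_image incident_edges_grid[OF assms] by simp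

lemma degree_grid:
  assumes "(i, j) \<in> verts (grid_graph m n)"
  shows "degree (grid_graph m n) (i, j) =
    of_bool (1 < j) + of_bool (j < n) + of_bool (1 < i) + of_bool (i < m)"
proof -
  obtain i' j' where "i = Suc i'" "j = Suc j'"
    using assms by (cases i; cases j) (auto simp: verts_grid_graph)
  then show ?thesis
    unfolding degree_def incident_edges_grid[OF assms]
    by (cases "1 < j"; cases "j < n"; cases "1 < i"; cases "i < m")
      (simp_all add: doubleton_eq_iff)
qed

text \<open>The componentwise minimum recovers the endpoint that indexes an edge, and the projection
  to the first coordinate is a singleton exactly for edges inside a row. So two functions of the
  coordinates describe a colouring of edge sets.\<close>

definition grid_coloring ::
    "(nat \<Rightarrow> nat \<Rightarrow> nat) \<Rightarrow> (nat \<Rightarrow> nat \<Rightarrow> nat) \<Rightarrow> (nat \<times> nat) set \<Rightarrow> nat" where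
  "grid_coloring h v e =
     (let i = Min (fst ` e); j = Min (snd ` e) in if card (fst ` e) = 1 then h i j else v i j)"

lemma grid_coloring_hedge [simp]: "grid_coloring h v (hedge i j) = h i j"
  by (simp add: grid_coloring_def)

lemma grid_coloring_vedge [simp]: "grid_coloring h v (vedge i j) = v i j"
  by (simp add: grid_coloring_def)

section \<open>Colourings\<close>

text \<open>Every row alternates between 1 and 2, and the columns supply the rest. Inner columns
  alternate between 3 and 4. Column 1 sees only 1 from the rows, so it alternates between 2 and 3.
  Column \<open>n\<close> sees only the last row colour, so it alternates between the other one of
  1, 2 and the colour 3.\<close>

lemma even_grid_coloring:
  assumes "even m" "2 \<le> m" "2 \<le> n"
  obtains \<phi> where "\<And>x. x \<in> verts (grid_graph m n) \<Longrightarrow>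
    palette (grid_graph m n) \<phi> x = {1..degree (grid_graph m n) x}"
proof
  define h :: "nat \<Rightarrow> nat \<Rightarrow> nat" where "h i j = (if odd j then 1 else 2)" for i j
  define v :: "nat \<Rightarrow> nat \<Rightarrow> nat" where
    "v i j = (if j = 1 then if odd i then 2 else 3
      else if j = n then if even i then 3 else if odd n then 1 else 2
      else if odd i then 3 else 4)" for i j
  fix x assume x: "x \<in> verts (grid_graph m n)"
  obtain i j where ij: "x = (Suc i, Suc j)" "i < m" "j < n"
    using x by (cases "fst x"; cases "snd x"; cases x) (auto simp: verts_grid_graph)
  have row: "(if 1 < Suc j then {h (Suc i) (Suc j - 1)} else {}) \<union> (if Suc j < n then {h (Suc i) (Suc j)} else {}) =
      (if j = 0 then {1} else if n = Suc j then {if odd n then 2 else 1} else {1, 2})"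
    using ij(3) assms(3) by (auto simp: h_def)
  have column: "(if 1 < Suc i then {v (Suc i - 1) (Suc j)} else {}) \<union> (if Suc i < m then {v (Suc i) (Suc j)} else {}) =
      (if i = 0 \<or> m = Suc i then {v 1 (Suc j)} else {v 1 (Suc j), v 2 (Suc j)})"
  proof -
    \<comment> \<open>Column colours depend on \<open>i\<close> only through its parity. As
      \<open>m\<close> is even, the last edge of a column has odd index \<open>m - 1\<close> and
      repeats the colour of the first, so both ends of a column look alike.\<close>
    have "v k l = v (if odd k then 1 else 2) l" for k l by (simp add: v_def)
    from this[of i] this[of "Suc i"] show ?thesis
      using ij(2) assms by (cases "odd i") (auto simp del: One_nat_def)
  qed
  have I: "{1..2::nat} = {1, 2}" "{1..3::nat} = {1, 2, 3}" "{1..4::nat} = {1, 2, 3, 4}"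
    by auto
  have "palette (grid_graph m n) (grid_coloring h v) x =
      (if j = 0 then {1} else if n = Suc j then {if odd n then 2 else 1} else {1, 2}) \<union>
      (if i = 0 \<or> m = Suc i then {v 1 (Suc j)} else {v 1 (Suc j), v 2 (Suc j)})"
    unfolding ij(1) palette_grid[OF x[unfolded ij(1)]] grid_coloring_hedge grid_coloring_vedge
      Un_assoc[of _ "if 1 < Suc i then _ else _"] row column ..
  moreover have "degree (grid_graph m n) x =
      (if j = 0 \<or> n = Suc j then 1 else 2) + (if i = 0 \<or> m = Suc i then 1 else 2)"
    using ij(2,3) assms unfolding ij(1) degree_grid[OF x[unfolded ij(1)]] by auto
  ultimately show "palette (grid_graph m n) (grid_coloring h v) x = {1..degree (grid_graph m n) x}"
    using assms(3) by (auto simp: v_def I)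
qed

lemma palette_index_even_grid:
  assumes "even m" "2 \<le> m" "2 \<le> n"
  shows "palette_index (grid_graph m n) = card (degree (grid_graph m n) ` verts (grid_graph m n))"
proof (rule antisym)
  let ?G = "grid_graph m n"
  obtain \<phi> where \<phi>: "\<And>x. x \<in> verts ?G \<Longrightarrow> palette ?G \<phi> x = {1..degree ?G x}"
    using even_grid_coloring[OF assms] by blast
  have "proper_edge_coloring ?G \<phi>"
    by (rule proper_edge_coloringI) (simp_all add: simple_graph_grid_graph finite_edges_grid \<phi>)
  then have "palette_index ?G \<le> card ((\<lambda>k. {1..k}) ` degree ?G ` verts ?G)"
    by (rule palette_index_le) (auto simp: \<phi> finite_verts_grid)
  also have "\<dots> \<le> card (degree ?G ` verts ?G)"
    by (simp add: card_image_le finite_verts_grid)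
  finally show "palette_index ?G \<le> card (degree ?G ` verts ?G)" .
qed (simp add: card_degrees_le_palette_index finite_edges_grid finite_verts_grid)

lemma palette_index_odd_grid_le:
  assumes "odd m" "odd n" "3 \<le> m" "3 \<le> n"
  shows "palette_index (grid_graph m n) \<le> 5"
proof -
  let ?G = "grid_graph m n"
  \<comment> \<open>The corner \<open>(m, 1)\<close> gets {3, 4} and the other corners {1, 2}; side
    vertices in rows 1 and \<open>m\<close> get {1, 2, 3}, those in columns 1 and \<open>n\<close>
    get {1, 2, 4}; the interior sees all four colours.\<close>
  define h :: "nat \<Rightarrow> nat \<Rightarrow> nat" where
    "h i j = (if i = 1 then if odd j then 1 else 2
      else if i = m then if odd j then 3 else 1
      else if odd j then 1 else 4)" for i j
  define v :: "nat \<Rightarrow> nat \<Rightarrow> nat" where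
    "v i j = (if j = 1 then if odd i then 2 else 4
      else if j = n then if odd i then 1 else 2
      else if odd i then 3 else 2)" for i j
  let ?\<phi> = "grid_coloring h v"
  let ?S = "{{1, 2}, {3, 4}, {1, 2, 3}, {1, 2, 4}, {1, 2, 3, 4}} :: nat set set"
  have *: "palette ?G ?\<phi> x \<in> ?S \<and> card (palette ?G ?\<phi> x) = degree ?G x" if x: "x \<in> verts ?G" for x
  proof -
    obtain i j where ij: "x = (Suc i, Suc j)" "i < m" "j < n"
      using x by (cases "fst x"; cases "snd x"; cases x) (auto simp: verts_grid_graph)
    \<comment> \<open>First, middle or last position; counted from 0, the last index is even because
      the side lengths are odd, which fixes the colours of the last edges.\<close>
    have "j = 0 \<or> Suc j < n \<and> j > 0 \<or> n = Suc j \<and> even j \<and> j > 0"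
      "i = 0 \<or> Suc i < m \<and> i > 0 \<or> m = Suc i \<and> even i \<and> i > 0"
      using ij(2,3) assms by presburger+
    then show ?thesis
      using x assms unfolding ij(1) palette_grid[OF x[unfolded ij(1)]] degree_grid[OF x[unfolded ij(1)]]
        grid_coloring_hedge grid_coloring_vedge
      by (elim disjE conjE; cases "odd i"; cases "odd j")
        (simp_all add: h_def v_def insert_commute)
  qed
  have "proper_edge_coloring ?G ?\<phi>"
    using * by (intro proper_edge_coloringI) (simp_all add: simple_graph_grid_graph finite_edges_grid)
  then have "palette_index ?G \<le> card ?S"
    by (rule palette_index_le) (intro image_subsetI conjunct1[OF *], simp_all)
  also have "\<dots> \<le> 5" by (simp add: card_insert_if)
  finally show ?thesis .
qed

section \<open>Degrees that occur in a grid\<close>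

lemma degrees_grid:
  assumes "2 \<le> m" "2 \<le> n"
  shows "degree (grid_graph m n) ` verts (grid_graph m n) =
    {2} \<union> (if max m n \<ge> 3 then {3} else {}) \<union> (if min m n \<ge> 3 then {4} else {})" (is "?L = ?R")
proof
  show "?L \<subseteq> ?R"
  proof (rule image_subsetI)
    fix x assume x: "x \<in> verts (grid_graph m n)"
    obtain i j where ij: "x = (i, j)" by fastforce
    show "degree (grid_graph m n) x \<in> ?R"
      unfolding ij degree_grid[OF x[unfolded ij]] using x[unfolded ij] assms
      by (auto simp: verts_grid_graph of_bool_def max_def min_def)
  qed
  have mem: "degree (grid_graph m n) (i, j) \<in> ?L" if "1 \<le> i" "i \<le> m" "1 \<le> j" "j \<le> n" for i j
    using that by (simp add: verts_grid_graph)
  have "degree (grid_graph m n) (1, 1) = 2"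
    using assms by (subst degree_grid) (auto simp: verts_grid_graph)
  then have "2 \<in> ?L" using mem[of 1 1] assms by simp
  moreover have "3 \<in> ?L" if "3 \<le> max m n"
  proof (cases "3 \<le> m")
    case True
    then have "degree (grid_graph m n) (2, 1) = 3"
      using assms by (subst degree_grid) (auto simp: verts_grid_graph)
    then show ?thesis using mem[of 2 1] assms True by simp
  next
    case False
    then have "degree (grid_graph m n) (1, 2) = 3"
      using assms that by (subst degree_grid) (auto simp: verts_grid_graph)
    then show ?thesis using mem[of 1 2] assms False by simp
  qed
  moreover have "4 \<in> ?L" if "3 \<le> min m n"
  proof -
    have "degree (grid_graph m n) (2, 2) = 4"
      using assms that by (subst degree_grid) (auto simp: verts_grid_graph)
    then show ?thesis using mem[of 2 2] assms by simp
  qed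
  ultimately show "?R \<subseteq> ?L" by simp
qed

section \<open>Odd grids need five palettes\<close>

lemma card_filter_mem_const:
  assumes "\<And>x. x \<in> S \<Longrightarrow> g x = A"
  shows "card {x \<in> S. c \<in> g x} = (if c \<in> A then card S else 0)"
proof -
  have "{x \<in> S. c \<in> g x} = (if c \<in> A then S else {})"
    using assms by auto
  then show ?thesis by simp
qed

lemma card_filter_mem_two:
  assumes "finite S" "g ` S = {A, B}" "A \<noteq> B"
  shows "card {x \<in> S. c \<in> g x} =
    (if c \<in> A then card {x \<in> S. g x = A} else 0) + (if c \<in> B then card {x \<in> S. g x = B} else 0)"
proof -
  have "{x \<in> S. c \<in> g x} =
      (if c \<in> A then {x \<in> S. g x = A} else {}) \<union> (if c \<in> B then {x \<in> S. g x = B} else {})"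
    using assms(2) by auto
  moreover have "(if c \<in> A then {x \<in> S. g x = A} else {}) \<inter> (if c \<in> B then {x \<in> S. g x = B} else {}) = {}"
    using assms(3) by auto
  ultimately show ?thesis
    using assms(1) by (simp add: card_Un_disjoint)
qed

lemma card_filter_two:
  assumes "finite S" "g ` S = {A, B}" "A \<noteq> B"
  shows "card {x \<in> S. g x = A} + card {x \<in> S. g x = B} = card S"
proof -
  have "S = {x \<in> S. g x = A} \<union> {x \<in> S. g x = B}" using assms(2) by auto
  then show ?thesis
    using assms(1,3) by (subst (3) \<open>S = _\<close>, subst card_Un_disjoint) auto
qed

lemma card_filter_Un_disjoint:
  assumes "finite A" "finite B" "A \<inter> B = {}"
  shows "card {x \<in> A \<union> B. P x} = card {x \<in> A. P x} + card {x \<in> B. P x}"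
proof -
  have "{x \<in> A \<union> B. P x} = {x \<in> A. P x} \<union> {x \<in> B. P x}" by auto
  then show ?thesis using assms by (simp add: card_Un_disjoint disjoint_iff)
qed

text \<open>The colouring is an arbitrary proper one; the lower bound is shown for it and later
  applied to an optimal colouring.\<close>

locale odd_grid =
  fixes m n :: nat and \<phi> :: "(nat \<times> nat) set \<Rightarrow> nat"
  assumes odd: "odd m" "odd n" and ge3: "3 \<le> m" "3 \<le> n"
    and proper: "proper_edge_coloring (grid_graph m n) \<phi>"
begin

abbreviation "G \<equiv> grid_graph m n"
abbreviation "pal \<equiv> palette G \<phi>"

section \<open>Corners, sides and interior\<close>

definition corners :: "(nat \<times> nat) set" where
  "corners = {1, m} \<times> {1, n}"

definition interior :: "(nat \<times> nat) set" where
  "interior = {1<..<m} \<times> {1<..<n}"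

definition sides :: "(nat \<times> nat) set" where
  "sides = verts G - corners - interior"

lemma verts_split: "verts G = corners \<union> sides \<union> interior"
  using ge3 by (auto simp: sides_def corners_def interior_def verts_grid_graph)

lemma disjoint: "corners \<inter> sides = {}" "corners \<inter> interior = {}" "sides \<inter> interior = {}"
  using ge3 by (auto simp: sides_def corners_def interior_def)

lemma finite_parts [simp]: "finite corners" "finite sides" "finite interior"
  using finite_verts_grid[of m n] unfolding verts_split by simp_all

lemma card_corners: "card corners = 4"
  using ge3 by (simp add: corners_def card_cartesian_product)

lemma odd_card_interior: "odd (card interior)"
  using odd ge3 by (simp add: interior_def card_cartesian_product)

lemma even_card_sides: "even (card sides)"
proof -
  have "card (verts G) = card corners + card sides + card interior"
    unfolding verts_split using disjoint by (simp add: card_Un_disjoint Int_Un_distrib2)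
  moreover have "odd (card (verts G))"
    using odd by (simp add: verts_grid_graph card_cartesian_product)
  ultimately show ?thesis
    using odd_card_interior card_corners by simp
qed

lemma in_sides_iff:
  "(i, j) \<in> sides \<longleftrightarrow> (i = 1 \<or> i = m) \<and> 1 < j \<and> j < n \<or> (j = 1 \<or> j = n) \<and> 1 < i \<and> i < m"
  using ge3 unfolding sides_def corners_def interior_def verts_grid_graph
    Diff_iff mem_Times_iff fst_conv snd_conv atLeastAtMost_iff greaterThanLessThan_iff insert_iff empty_iff
  by presburger

lemma in_sidesE:
  assumes "x \<in> sides"
  obtains (top) j where "x = (1, j)" "1 < j" "j < n"
    | (bottom) j where "x = (m, j)" "1 < j" "j < n"
    | (left) i where "x = (i, 1)" "1 < i" "i < m"
    | (right) i where "x = (i, n)" "1 < i" "i < m"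
  using assms by (cases x) (auto simp: in_sides_iff)

lemma card_pal_corner: "x \<in> corners \<Longrightarrow> card (pal x) = 2"
  unfolding card_palette_eq_degree[OF proper] using ge3
  by (cases x, hypsubst, subst degree_grid) (auto simp: corners_def verts_grid_graph)

lemma card_pal_side: "x \<in> sides \<Longrightarrow> card (pal x) = 3"
  unfolding card_palette_eq_degree[OF proper] using ge3
  by (cases x, hypsubst, subst degree_grid) (auto simp: in_sides_iff verts_grid_graph)

lemma card_pal_interior: "x \<in> interior \<Longrightarrow> card (pal x) = 4"
  unfolding card_palette_eq_degree[OF proper] using ge3
  by (cases x, hypsubst, subst degree_grid) (auto simp: interior_def verts_grid_graph)

text \<open>Since both lengths are at least 3, a neighbour of a corner is never a corner. Hence
  every colour at a corner also occurs in a side palette.\<close>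

lemma corner_edge_meets_sides:
  assumes "e \<in> edges G" "x \<in> e" "x \<in> corners"
  shows "\<exists>y \<in> sides. y \<in> e"
proof -
  from assms(1) consider (h) i j where "e = hedge i j" "1 \<le> i" "i \<le> m" "1 \<le> j" "j < n"
    | (v) i j where "e = vedge i j" "1 \<le> i" "i < m" "1 \<le> j" "j \<le> n"
    unfolding edges_grid_graph by fastforce
  then show ?thesis
  proof cases
    case h
    have "(i, j) \<in> corners \<or> (i, Suc j) \<in> corners" using assms(2,3) by (auto simp: h(1))
    then have "(i = 1 \<or> i = m) \<and> (j = 1 \<or> Suc j = n)"
      using h(2-5) by (auto simp: corners_def)
    then have "(i, j) \<in> sides \<or> (i, Suc j) \<in> sides"
      using ge3 h(2-5) unfolding in_sides_iff by presburger
    then show ?thesis by (auto simp: h(1))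
  next
    case v
    have "(i, j) \<in> corners \<or> (Suc i, j) \<in> corners" using assms(2,3) by (auto simp: v(1))
    then have "(i = 1 \<or> Suc i = m) \<and> (j = 1 \<or> j = n)"
      using v(2-5) by (auto simp: corners_def)
    then have "(i, j) \<in> sides \<or> (Suc i, j) \<in> sides"
      using ge3 v(2-5) unfolding in_sides_iff by presburger
    then show ?thesis by (auto simp: v(1))
  qed
qed

lemma mem_palI: "e \<in> edges G \<Longrightarrow> x \<in> e \<Longrightarrow> \<phi> e \<in> pal x"
  by (simp add: palette_def)

lemma corner_color_in_sides:
  assumes "x \<in> corners" "c \<in> pal x"
  shows "\<exists>y \<in> sides. c \<in> pal y"
proof -
  from assms(2) obtain e where "e \<in> edges G" "x \<in> e" "\<phi> e = c" by (auto simp: palette_def)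
  then show ?thesis using corner_edge_meets_sides[OF _ _ assms(1)] mem_palI by blast
qed

text \<open>Being disjoint from \<open>interior\<close> singles out the edges of the boundary cycle.
  Of the three edges at a side vertex, two run along this cycle and one leads inward.\<close>

lemma card_boundary_edges:
  assumes "x \<in> sides"
  shows "card {e \<in> incident_edges G x. e \<inter> interior = {}} = 2"
proof -
  have V: "x \<in> verts G" using assms by (simp add: sides_def)
  note inc = incident_edges_grid[of _ _ m n]
  have triple: ?thesis if "incident_edges G x = {a, b, c}" "a \<noteq> b"
    "a \<inter> interior = {}" "b \<inter> interior = {}" "c \<inter> interior \<noteq> {}" for a b c
  proof -
    have "{e \<in> {a, b, c}. Q e} = {a, b}" if "Q a" "Q b" "\<not> Q c" for Q using that by auto
    from this[of "\<lambda>e. e \<inter> interior = {}"]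
    have "{e \<in> incident_edges G x. e \<inter> interior = {}} = {a, b}" using that by simp
    then show ?thesis using that(2) by simp
  qed
  from assms show ?thesis
  proof (cases rule: in_sidesE)
    case (top j)
    then obtain k where k: "j = Suc k" "0 < k" by (cases j) auto
    show ?thesis
    proof (rule triple)
      show "incident_edges G x = {hedge 1 k, hedge 1 j, vedge 1 j}"
        using V top ge3 k unfolding top(1) by (subst inc) (simp_all add: insert_commute)
    qed (use top k ge3 in \<open>simp_all add: interior_def doubleton_eq_iff\<close>)
  next
    case (bottom j)
    then obtain k where k: "j = Suc k" "0 < k" by (cases j) auto
    show ?thesis
    proof (rule triple)
      show "incident_edges G x = {hedge m k, hedge m j, vedge (m - 1) j}"
        using V bottom ge3 k unfolding bottom(1) by (subst inc) (simp_all add: insert_commute)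
    qed (use bottom k ge3 in \<open>simp_all add: interior_def doubleton_eq_iff\<close>)
  next
    case (left i)
    then obtain k where k: "i = Suc k" "0 < k" by (cases i) auto
    show ?thesis
    proof (rule triple)
      show "incident_edges G x = {vedge k 1, vedge i 1, hedge i 1}"
        using V left ge3 k unfolding left(1) by (subst inc) (simp_all add: insert_commute)
    qed (use left k ge3 in \<open>simp_all add: interior_def doubleton_eq_iff\<close>)
  next
    case (right i)
    then obtain k where k: "i = Suc k" "0 < k" by (cases i) auto
    show ?thesis
    proof (rule triple)
      show "incident_edges G x = {vedge k n, vedge i n, hedge i (n - 1)}"
        using V right ge3 k unfolding right(1) by (subst inc) (simp_all add: insert_commute)
    qed (use right k ge3 in \<open>simp_all add: interior_def doubleton_eq_iff\<close>)
  qed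
qed

section \<open>Parity arguments against at most four palettes\<close>

lemma even_color_count:
  "even (card {x \<in> corners. c \<in> pal x} + card {x \<in> sides. c \<in> pal x} + card {x \<in> interior. c \<in> pal x})"
proof -
  have "card {x \<in> verts G. c \<in> pal x} =
      card {x \<in> corners. c \<in> pal x} + card {x \<in> sides. c \<in> pal x} + card {x \<in> interior. c \<in> pal x}"
    unfolding verts_split using disjoint
    by (simp add: card_filter_Un_disjoint Int_Un_distrib2 del: Un_iff)
  then show ?thesis
    using even_card_vertices_with_color[OF simple_graph_grid_graph finite_edges_grid proper, of c]
    by presburger
qed

text \<open>A colour of \<open>D\<close> is seen by oddly many interior vertices and evenly many
  side vertices, so some corner sees it, and then \<open>P\<close> contains it. This puts the four
  colours of \<open>D\<close> into the three of \<open>P\<close>.\<close>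

lemma no_single_side_and_interior_palette:
  assumes P: "\<And>x. x \<in> sides \<Longrightarrow> pal x = P" and D: "\<And>x. x \<in> interior \<Longrightarrow> pal x = D"
  shows False
proof -
  obtain s where s: "s \<in> sides" using ge3 in_sides_iff[of 1 2] by auto
  have t: "(2, 2) \<in> interior" using ge3 by (simp add: interior_def)
  have "c \<in> P" if "c \<in> D" for c
  proof -
    have "odd (card {x \<in> corners. c \<in> pal x})"
      using even_color_count[of c] odd_card_interior even_card_sides that
        card_filter_mem_const[of sides pal P c, OF P] card_filter_mem_const[of interior pal D c, OF D]
      by (auto split: if_splits)
    then obtain x where "x \<in> corners" "c \<in> pal x"
      by (metis (mono_tags, lifting) card.empty empty_Collect_eq even_zero)
    then show ?thesis using corner_color_in_sides P by blast
  qed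
  moreover have "card P = 3" "card D = 4"
    using card_pal_side[OF s] card_pal_interior[OF t] P[OF s] D[OF t] by auto
  ultimately show False
    using card_mono[of P D] card_ge_0_finite[of P] by auto
qed

text \<open>Corners and sides contribute evenly to each colour, so the interior must too. But one of
  the two interior classes is odd, and a colour in its palette only is counted oddly often.\<close>

lemma no_single_corner_and_side_palette:
  assumes C: "\<And>x. x \<in> corners \<Longrightarrow> pal x = C" and P: "\<And>x. x \<in> sides \<Longrightarrow> pal x = P"
    and D: "pal ` interior = {A, B}" "A \<noteq> B"
  shows False
proof -
  have even: "even (card {x \<in> interior. c \<in> pal x})" for c
    using even_color_count[of c] even_card_sides card_corners
      card_filter_mem_const[of sides pal P c, OF P] card_filter_mem_const[of corners pal C c, OF C]
    by (auto split: if_splits)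
  have main: False if D: "pal ` interior = {A, B}" "A \<noteq> B" and "odd (card {x \<in> interior. pal x = A})" for A B
  proof -
    have "card A = 4" "card B = 4" using D(1) card_pal_interior by (metis imageE insertCI)+
    then obtain c where "c \<in> A" "c \<notin> B"
      using D(2) card_subset_eq[of B A] card_ge_0_finite[of B] by auto
    then show False
      using even[of c] card_filter_mem_two[OF finite_parts(3) D, of c] that(3) by simp
  qed
  have "odd (card {x \<in> interior. pal x = A}) \<or> odd (card {x \<in> interior. pal x = B})"
    using odd_card_interior unfolding card_filter_two[OF finite_parts(3) D, symmetric] by simp
  moreover have "pal ` interior = {B, A}" "B \<noteq> A" using D by (simp_all add: insert_commute)
  ultimately show False using main[OF D] main[of B A] by blast
qed

lemma no_single_corner_and_interior_palette:
  assumes C: "\<And>x. x \<in> corners \<Longrightarrow> pal x = C" and D: "\<And>x. x \<in> interior \<Longrightarrow> pal x = D"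
    and PQ: "pal ` sides = {P, Q}" "P \<noteq> Q"
  shows False
proof -
  have corner: "(1, 1) \<in> corners" "(1, n) \<in> corners" by (auto simp: corners_def)
  have "card C = 2" using card_pal_corner[OF corner(1)] C[OF corner(1)] by simp
  have "(2, 2) \<in> interior" using ge3 by (simp add: interior_def)
  then have "card D = 4" using card_pal_interior D by metis
  have "card P = 3" "card Q = 3" using PQ(1) card_pal_side by (metis imageE insertCI)+
  have fin: "finite P" "finite Q" "finite C" "finite D"
    using \<open>card P = 3\<close> \<open>card Q = 3\<close> \<open>card C = 2\<close> \<open>card D = 4\<close> by (simp_all add: card_ge_0_finite)
  define p where "p = card {x \<in> sides. pal x = P}"
  define q where "q = card {x \<in> sides. pal x = Q}"
  \<comment> \<open>The four corners contribute 0 or 4, so the side count of \<open>c\<close> has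
    the parity of its interior count.\<close>
  have parity: "odd ((if c \<in> P then p else 0) + (if c \<in> Q then q else 0)) \<longleftrightarrow> c \<in> D" for c
  proof -
    have "even (card {x \<in> corners. c \<in> pal x})"
      using card_filter_mem_const[of corners pal C c, OF C] card_corners by simp
    moreover have "odd (card {x \<in> interior. c \<in> pal x}) \<longleftrightarrow> c \<in> D"
      using card_filter_mem_const[of interior pal D c, OF D] odd_card_interior by simp
    ultimately show ?thesis
      using even_color_count[of c]
      unfolding p_def q_def card_filter_mem_two[OF finite_parts(2) PQ, symmetric] by simp
  qed
  have "even (p + q)"
    using card_filter_two[OF finite_parts(2) PQ] even_card_sides unfolding p_def q_def by simp
  moreover have "\<not> (even p \<and> even q)"
  proof
    assume "even p \<and> even q"
    then have "c \<notin> D" for c using parity[of c] by (auto split: if_splits)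
    then have "D = {}" by blast
    then show False using \<open>card D = 4\<close> by simp
  qed
  ultimately have odd_pq: "odd p" "odd q" by auto
  then have "c \<in> D \<longleftrightarrow> c \<in> (P - Q) \<union> (Q - P)" for c
    using parity[of c] by (simp split: if_splits)
  then have D_eq: "D = (P - Q) \<union> (Q - P)" by (rule set_eqI)
  \<comment> \<open>With \<open>k\<close> common colours the symmetric difference has
    \<open>6 - 2 * k\<close> elements, and \<open>D\<close> has four.\<close>
  have "card (P \<inter> Q) = 1"
  proof -
    have "card D = card (P - Q) + card (Q - P)"
      unfolding D_eq using fin by (intro card_Un_disjoint) auto
    moreover have "card P = card (P \<inter> Q) + card (P - Q)" "card Q = card (P \<inter> Q) + card (Q - P)"
      using fin card_Int_Diff[of P Q] card_Int_Diff[of Q P] by (simp_all add: Int_commute)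
    ultimately show ?thesis using \<open>card P = 3\<close> \<open>card Q = 3\<close> \<open>card D = 4\<close> by linarith
  qed
  then obtain x where x: "P \<inter> Q = {x}" by (rule card_1_singletonE)
  then have "x \<notin> D" using D_eq by auto
  have x_side: "x \<in> pal s" if "s \<in> sides" for s
    using that x PQ(1) by blast
  have interior_color: "\<phi> e \<noteq> x" if "e \<in> edges G" "e \<inter> interior \<noteq> {}" for e
    using that D mem_palI \<open>x \<notin> D\<close> by blast
  \<comment> \<open>The edge of colour \<open>x\<close> at a side vertex cannot lead inward, so it
    is one of the two boundary edges; the other one is the edge claimed.\<close>
  have other_boundary_edge: "\<exists>!f. f \<in> edges G \<and> s \<in> f \<and> f \<inter> interior = {} \<and> \<phi> f \<noteq> x"
    if s: "s \<in> sides" for s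
  proof -
    obtain e where e: "e \<in> edges G" "s \<in> e" "\<phi> e = x"
      using x_side[OF s] by (auto simp: palette_def)
    define B where "B = {e \<in> incident_edges G s. e \<inter> interior = {}}"
    have "e \<in> B" using e interior_color by (auto simp: B_def incident_edges_def)
    moreover have "card B = 2" unfolding B_def by (rule card_boundary_edges[OF s])
    ultimately obtain f where B: "B = {e, f}" "e \<noteq> f"
      by (metis card_2_iff doubleton_eq_iff insertE singletonD)
    have B_iff: "g \<in> B \<longleftrightarrow> g \<in> edges G \<and> s \<in> g \<and> g \<inter> interior = {}" for g
      by (auto simp: B_def incident_edges_def)
    have "\<phi> f \<noteq> x"
      using B e B_iff proper_edge_coloringD[OF proper, of e f s] by blast
    then show ?thesis using B e(3) B_iff by (metis insertE insertCI singletonD)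
  qed
  \<comment> \<open>Along the top row the colour \<open>x\<close> alternates, and the row has an even number of edges.\<close>
  have "x \<in> C"
  proof (rule ccontr)
    assume "x \<notin> C"
    have "1 \<le> k \<Longrightarrow> k < n \<Longrightarrow> \<phi> (hedge 1 k) = x \<longleftrightarrow> even k" for k
    proof (induction k)
      case (Suc k)
      show ?case
      proof (cases "k = 0")
        \<comment> \<open>The induction really starts at the first edge: the corner
          \<open>(1, 1)\<close> misses \<open>x\<close>, in accordance with 1 being odd.\<close>
        case True
        have "\<phi> (hedge 1 1) \<in> pal (1, 1)"
          using ge3 hedge_in_edges[of 1 1 m n] by (intro mem_palI) auto
        then show ?thesis using C[OF corner(1)] \<open>x \<notin> C\<close> True by auto
      next
        case False
        have s: "(1, Suc k) \<in> sides" using False Suc.prems by (simp add: in_sides_iff)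
        have "pal (1, Suc k) = {\<phi> (hedge 1 k), \<phi> (hedge 1 (Suc k)), \<phi> (vedge 1 (Suc k))}"
          using False Suc.prems ge3 s by (subst palette_grid) (auto simp: sides_def)
        moreover have "\<phi> (vedge 1 (Suc k)) \<noteq> x"
          using False Suc.prems ge3 vedge_in_edges[of 1 "Suc k" m n]
          by (intro interior_color) (auto simp: interior_def)
        ultimately have "\<phi> (hedge 1 k) = x \<or> \<phi> (hedge 1 (Suc k)) = x"
          using x_side[OF s] by auto
        moreover have "\<phi> (hedge 1 k) \<noteq> \<phi> (hedge 1 (Suc k))"
        proof
          assume "\<phi> (hedge 1 k) = \<phi> (hedge 1 (Suc k))"
          then have "hedge 1 k = hedge 1 (Suc k)"
            using False Suc.prems ge3 hedge_in_edges[of 1 k m n] hedge_in_edges[of 1 "Suc k" m n]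
            by (intro proper_edge_coloringD[OF proper, of _ _ "(1, Suc k)"]) auto
          then show False by (simp add: doubleton_eq_iff)
        qed
        ultimately show ?thesis using Suc False by auto
      qed
    qed simp
    from this[of "n - 1"] have "\<phi> (hedge 1 (n - 1)) = x" using odd(2) ge3 by simp
    moreover have "\<phi> (hedge 1 (n - 1)) \<in> pal (1, n)"
      using ge3 hedge_in_edges[of 1 "n - 1" m n] by (intro mem_palI) auto
    ultimately show False using C[OF corner(2)] \<open>x \<notin> C\<close> by simp
  qed
  then have "card (C - {x}) = 1" using \<open>card C = 2\<close> by (simp add: fin)
  then obtain a where a: "C - {x} = {a}" by (rule card_1_singletonE)
  then have "C \<subseteq> {x, a}" by auto
  \<comment> \<open>Stated for either order of the two side palettes. A colour in
    \<open>R - {x}\<close> lies neither in \<open>S\<close> nor in \<open>C\<close>, so a boundary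
    edge with such a colour has both ends in the class of \<open>R\<close>. These edges form the
    matching \<open>M\<close>, which covers the class by \<open>other_boundary_edge\<close>.\<close>
  have even_side_class: "even (card {s \<in> sides. pal s = R})"
    if "pal ` sides = {S, R}" "S \<inter> R = {x}" "a \<notin> R" for R S
  proof -
    define M where "M = {e \<in> edges G. e \<inter> interior = {} \<and> \<phi> e \<in> R - {x}}"
    have M_side: "v \<in> sides \<and> pal v = R" if "e \<in> M" "v \<in> e" for e v
    proof -
      have e: "e \<in> edges G" "e \<inter> interior = {}" "\<phi> e \<in> R" "\<phi> e \<noteq> x"
        using that(1) by (auto simp: M_def)
      have "v \<in> verts G"
        using e(1) that(2) simple_graph_grid_graph[of m n] by (auto simp: simple_graph_def)
      moreover have "\<phi> e \<in> pal v" by (rule mem_palI[OF e(1) that(2)])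
      moreover have "\<phi> e \<notin> C" using \<open>C \<subseteq> {x, a}\<close> e(3,4) \<open>a \<notin> R\<close> by auto
      ultimately have "v \<in> sides"
        using C[of v] e(2) that(2) unfolding verts_split by auto
      moreover from this have "pal v = S \<or> pal v = R"
        using imageI[of v sides pal] unfolding \<open>pal ` sides = {S, R}\<close> by simp
      moreover have "\<phi> e \<notin> S" using IntI[of "\<phi> e" S R] e(3,4) unfolding \<open>S \<inter> R = {x}\<close> by auto
      ultimately show ?thesis using \<open>\<phi> e \<in> pal v\<close> by auto
    qed
    have "{s \<in> sides. pal s = R} = \<Union>M"
    proof (intro equalityI subsetI)
      fix s assume s: "s \<in> {s \<in> sides. pal s = R}"
      then obtain f where f: "f \<in> edges G" "s \<in> f" "f \<inter> interior = {}" "\<phi> f \<noteq> x"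
        using ex1_implies_ex[OF other_boundary_edge[of s]] by auto
      then have "f \<in> M" using s mem_palI[OF f(1,2)] by (simp add: M_def)
      then show "s \<in> \<Union>M" using f(2) by blast
    next
      fix s assume "s \<in> \<Union>M"
      then show "s \<in> {s \<in> sides. pal s = R}" using M_side by blast
    qed
    moreover have "card (\<Union>M) = 2 * card M"
    proof (rule card_Union_disjoint_pairs)
      show "finite M" unfolding M_def using finite_edges_grid[of m n] by simp
      show "card e = 2" if "e \<in> M" for e
        using that simple_graph_grid_graph[of m n] by (simp add: M_def simple_graph_def)
      show "e = f" if "e \<in> M" "f \<in> M" "v \<in> e" "v \<in> f" for e f v
      proof -
        have "v \<in> sides" using M_side that by blast
        from other_boundary_edge[OF this] show ?thesis using that by (auto simp: M_def)
      qed
    qed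
    ultimately show ?thesis by simp
  qed
  have "a \<noteq> x" using a by auto
  \<comment> \<open>The common part of \<open>P\<close> and \<open>Q\<close> is only
    \<open>x\<close>, so \<open>a\<close> is missing from one of them; the class of that palette is
    then even, against \<open>odd_pq\<close>.\<close>
  then consider "a \<notin> P" | "a \<notin> Q" using IntI[of a P Q] unfolding x by auto
  then show False
  proof cases
    case 1
    then show False
      using even_side_class[of Q P] PQ(1) x odd_pq by (simp add: insert_commute Int_commute p_def)
  next
    case 2
    then show False using even_side_class[of P Q] PQ(1) x odd_pq by (simp add: q_def)
  qed
qed

text \<open>Palettes of corners, sides and interior have sizes 2, 3 and 4, so the three families are
  disjoint and their numbers add up.\<close>

lemma five_le_card_palettes: "5 \<le> card (pal ` verts G)"
proof (rule ccontr)
  assume less: "\<not> 5 \<le> card (pal ` verts G)"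
  have "pal ` verts G = pal ` corners \<union> pal ` sides \<union> pal ` interior"
    unfolding verts_split by (simp add: image_Un)
  moreover have "pal ` corners \<inter> pal ` sides = {}" "(pal ` corners \<union> pal ` sides) \<inter> pal ` interior = {}"
    using card_pal_corner card_pal_side card_pal_interior by fastforce+
  ultimately have sum: "card (pal ` verts G) = card (pal ` corners) + card (pal ` sides) + card (pal ` interior)"
    by (simp add: card_Un_disjoint)
  have "(1, 1) \<in> corners" "(1, 2) \<in> sides" "(2, 2) \<in> interior"
    using ge3 by (simp_all add: corners_def in_sides_iff interior_def)
  then have "corners \<noteq> {}" "sides \<noteq> {}" "interior \<noteq> {}" by blast+
  then have "card (pal ` corners) \<ge> 1" "card (pal ` sides) \<ge> 1" "card (pal ` interior) \<ge> 1"
    by (simp_all add: Suc_le_eq card_gt_0_iff)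
  \<comment> \<open>Three positive numbers with sum at most 4: at most one of them is 2. The first
    case covers both one and two corner palettes.\<close>
  with sum less consider
    "card (pal ` sides) = 1" "card (pal ` interior) = 1"
    | "card (pal ` corners) = 1" "card (pal ` sides) = 1" "card (pal ` interior) = 2"
    | "card (pal ` corners) = 1" "card (pal ` interior) = 1" "card (pal ` sides) = 2"
    by linarith
  then show False
  proof cases
    case 1
    then show False
      using no_single_side_and_interior_palette by (metis card_1_singletonE imageI singletonD)
  next
    case 2
    obtain A B where AB: "pal ` interior = {A, B}" "A \<noteq> B" using 2(3) by (auto simp: card_2_iff)
    obtain C P where "pal ` corners = {C}" "pal ` sides = {P}"
      using 2(1,2) by (metis card_1_singletonE)
    then have "pal x = C" if "x \<in> corners" for x using that by blast
    moreover have "pal x = P" if "x \<in> sides" for x using that \<open>pal ` sides = {P}\<close> by blast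
    ultimately show False using AB by (rule no_single_corner_and_side_palette)
  next
    case 3
    obtain P Q where PQ: "pal ` sides = {P, Q}" "P \<noteq> Q" using 3(3) by (auto simp: card_2_iff)
    obtain C D where "pal ` corners = {C}" "pal ` interior = {D}"
      using 3(1,2) by (metis card_1_singletonE)
    then have "pal x = C" if "x \<in> corners" for x using that by blast
    moreover have "pal x = D" if "x \<in> interior" for x using that \<open>pal ` interior = {D}\<close> by blast
    ultimately show False using PQ by (rule no_single_corner_and_interior_palette)
  qed
qed

end

section \<open>Exact values of the palette index\<close>

lemma palette_index_odd_grid:
  assumes "odd m" "odd n" "3 \<le> m" "3 \<le> n"
  shows "palette_index (grid_graph m n) = 5"
proof (rule antisym[OF palette_index_odd_grid_le[OF assms]])
  obtain \<phi> where \<phi>: "proper_edge_coloring (grid_graph m n) \<phi>"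
    "card (palette (grid_graph m n) \<phi> ` verts (grid_graph m n)) = palette_index (grid_graph m n)"
    using palette_index_attained[OF finite_edges_grid] by blast
  then interpret odd_grid m n \<phi> using assms by unfold_locales
  show "5 \<le> palette_index (grid_graph m n)" using five_le_card_palettes \<phi>(2) by simp
qed

theorem theorem3p6:
  fixes m n :: nat
  assumes "m \<ge> 2" and "n \<ge> 2"
  shows "(m = 2 \<and> n = 2 \<longrightarrow> palette_index (grid_graph m n) = 1) \<and>
         (min m n = 2 \<and> max m n \<ge> 3 \<longrightarrow> palette_index (grid_graph m n) = 2) \<and>
         (m \<ge> 3 \<and> n \<ge> 3 \<and> even (m * n) \<longrightarrow> palette_index (grid_graph m n) = 3) \<and>
         (m \<ge> 3 \<and> n \<ge> 3 \<and> odd (m * n) \<longrightarrow> palette_index (grid_graph m n) = 5)"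
proof -
  \<comment> \<open>The summands count the degrees 2, 3 and 4 that occur, which yields the first
    three claims at once. If \<open>m\<close> is odd, then \<open>n\<close> is even and the grid is
    transposed.\<close>
  have even: "palette_index (grid_graph m n) =
      1 + (if max m n \<ge> 3 then 1 else 0) + (if min m n \<ge> 3 then 1 else 0)" if "even (m * n)"
  proof (cases "even m")
    case True
    then show ?thesis
      using palette_index_even_grid[of m n] degrees_grid[of m n] assms by (simp add: le_max_iff_disj)
  next
    case False
    then show ?thesis
      using palette_index_even_grid[of n m] degrees_grid[of n m] palette_index_grid_commute[of m n] assms that
      by (simp add: le_max_iff_disj conj_commute disj_commute)
  qed
  moreover have "even (m * n)" if "min m n = 2"
    using that by (auto simp: min_def split: if_splits)
  moreover have "palette_index (grid_graph m n) = 5" if "m \<ge> 3" "n \<ge> 3" "odd (m * n)"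
    using that by (intro palette_index_odd_grid) auto
  ultimately show ?thesis by auto
qed

end
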